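(* Let $\Bbbk$ be a field of characteristic different from $2$, let $p\in\Bbbk$ with $p^2=-1$, and let $\mathbb{E}$ be the $\Bbbk$-algebra generated by $y_1,y_2,x_1,x_2$ subject to the relations $$x_2x_1=-x_1x_2,\quad y_2y_1=p\,y_1y_2,\quad y_1x_1=x_1y_2+x_2y_2,\quad y_1x_2=x_1y_2-x_2y_2,$$ $$y_2x_1=-x_1y_1+x_2y_1,\quad y_2x_2=x_1y_1+x_2y_1.$$ Let $S\subset\Bbbk\{y_1,y_2,x_1,x_2\}$ be the set consisting of the six polynomials $$x_2x_1+x_1x_2,\quad y_2y_1-p\,y_1y_2,\quad x_2y_2-\tfrac12y_1x_1+\tfrac12y_1x_2,\quad x_1y_2-\tfrac12y_1x_1-\tfrac12y_1x_2,$$ $$x_2y_1-\tfrac12y_2x_1-\tfrac12y_2x_2,\quad x_1y_1+\tfrac12y_2x_1-\tfrac12y_2x_2.$$ Then, with respect to the degree lexicographic order with $y_1\prec y_2\prec x_1\prec x_2$, the set $S$ is a Gröbner-Shirshov basis of the ideal $\mathrm{Id}(S)$, which is the ideal of defining relations of $\mathbb{E}$, i.e. $\mathbb{E}=\Bbbk\{y_1,y_2,x_1,x_2\}/\mathrm{Id}(S)$.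
   Context: Let $X=\{y_1,y_2,x_1,x_2\}$, let $X^*$ be the free monoid of words in $X$, and let $\Bbbk\{X\}$ be the free associative unital $\Bbbk$-algebra on $X$ (noncommutative polynomials). $\mathrm{Id}(S)$ denotes the two-sided ideal of $\Bbbk\{X\}$ generated by $S$. The degree lexicographic order $\prec$ on $X^*$ compares words first by length and then, for equal length, lexicographically from left to right with $y_1\prec y_2\prec x_1\prec x_2$. For a nonzero $f\in\Bbbk\{X\}$, $\overline{f}$ denotes its leading (i.e. $\prec$-largest) word; $f$ is monic if the coefficient of $\overline{f}$ is $1$. For monic $f,g$: (i) if $w=\overline{f}a=b\overline{g}$ with $a,b\in X^*$ and $|\overline{f}|+|\overline{g}|>|w|$, then $(f,g)_w:=fa-bg$ is the intersection composition; (ii) if $w=\overline{f}=a\overline{g}b$ with $a,b\in X^*$, then $(f,g)_w:=f-agb$ is the inclusion composition. A composition $(f,g)_w$ is trivial modulo $S$ if $(f,g)_w=\sum_i\alpha_i a_is_ib_i$ (finite sum) with $\alpha_i\in\Bbbk$, $a_i,b_i\in X^*$, $s_i\in S$ and $a_i\overline{s_i}b_i\prec w$ for all $i$. A nonempty set $S$ of monic polynomials is a Gröbner-Shirshov basis of $\mathrm{Id}(S)$ if every composition $(f,g)_w$ with $f,g\in S$ is trivial modulo $S$. *)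

theory Defs
  imports "HOL-Library.Poly_Mapping" "HOL-Library.List_Lenlexorder" "HOL-Algebra.QuotRing" "HOL-Algebra.Module"
begin

text \<open>The free monoid: with this instance \<open>'x list \<Rightarrow>\<^sub>0 'k\<close> is the free associative unital algebra on
  \<open>'x\<close>, carrying the convolution product of \<^theory>\<open>HOL-Library.Poly_Mapping\<close>.  The order on words
  is \<^const>\<open>lenlex\<close>, i.e. first by length and then lexicographically from the left.\<close>

instantiation list :: (type) monoid_add
begin

definition zero_list :: "'a list" where "zero_list = []"

definition plus_list :: "'a list \<Rightarrow> 'a list \<Rightarrow> 'a list" where "plus_list = (@)"

instance by standard (simp_all add: zero_list_def plus_list_def)

end

type_synonym ('x, 'k) ncpoly = "'x list \<Rightarrow>\<^sub>0 'k"

definition word :: "'x list \<Rightarrow> ('x, 'k::field) ncpoly" where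
  "word w = Poly_Mapping.single w 1"

definition scale :: "'k::field \<Rightarrow> ('x, 'k) ncpoly \<Rightarrow> ('x, 'k) ncpoly" (infixr \<open>\<cdot>\<close> 75) where
  "c \<cdot> f = Poly_Mapping.map ((*) c) f"

definition free_alg :: "('k::field, ('x, 'k) ncpoly) module" where
  "free_alg = \<lparr>carrier = UNIV, mult = (*), one = 1, zero = 0, add = (+), smult = (\<cdot>)\<rparr>"

lemma ring_free_alg: "ring (free_alg :: ('k::field, ('x, 'k) ncpoly) module)"
proof -
  have "\<exists>y. y + x = 0 \<and> x + y = 0" for x :: "('x, 'k) ncpoly"
    by (rule exI[of _ "- x"]) simp
  then show ?thesis
    by unfold_locales
      (auto simp: free_alg_def Units_def algebra_simps)
qed

definition quot_alg :: "('k, 'a) module \<Rightarrow> 'a set \<Rightarrow> ('k, 'a set) module" where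
  "quot_alg A I =
     ring.extend (A Quot I) (module.fields (\<lambda>c C. \<Union>f\<in>C. I +>\<^bsub>A\<^esub> (c \<odot>\<^bsub>A\<^esub> f)))"

text \<open>A relation \<open>l = r\<close> is encoded as the pair \<open>(l, r)\<close>.\<close>

definition ideal_of_relations :: "(('x, 'k::field) ncpoly \<times> ('x, 'k) ncpoly) set \<Rightarrow> ('x, 'k) ncpoly set" where
  "ideal_of_relations R = Idl\<^bsub>free_alg\<^esub> {l - r | l r. (l, r) \<in> R}"

definition presented_alg ::
    "(('x, 'k::field) ncpoly \<times> ('x, 'k) ncpoly) set \<Rightarrow> ('k, ('x, 'k) ncpoly set) module" where
  "presented_alg R = quot_alg free_alg (ideal_of_relations R)"

text \<open>The leading word is meaningful only for nonzero polynomials.\<close>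

definition lead_word :: "('x::linorder, 'k::field) ncpoly \<Rightarrow> 'x list" where
  "lead_word f = Max (Poly_Mapping.keys f)"

definition monic :: "('x::linorder, 'k::field) ncpoly \<Rightarrow> bool" where
  "monic f \<longleftrightarrow> f \<noteq> 0 \<and> Poly_Mapping.lookup f (lead_word f) = 1"

text \<open>\<open>composition f g w h\<close> says that \<open>h\<close> is a composition \<open>(f, g)\<^sub>w\<close>.  It is a relation because an
  inclusion composition also depends on the occurrence of the leading word of \<open>g\<close> in \<open>w\<close>.\<close>

inductive composition ::
    "('x::linorder, 'k::field) ncpoly \<Rightarrow> ('x, 'k) ncpoly \<Rightarrow> 'x list \<Rightarrow> ('x, 'k) ncpoly \<Rightarrow> bool"
  for f g w where
  intersection: "composition f g w (f * word a - word b * g)"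
    if "w = lead_word f @ a" "w = b @ lead_word g"
       "length (lead_word f) + length (lead_word g) > length w"
| inclusion: "composition f g w (f - word a * g * word b)"
    if "w = lead_word f" "w = a @ lead_word g @ b"

definition trivial_modulo ::
    "('x::linorder, 'k::field) ncpoly set \<Rightarrow> 'x list \<Rightarrow> ('x, 'k) ncpoly \<Rightarrow> bool" where
  "trivial_modulo S w h \<longleftrightarrow>
     (\<exists>(n::nat) \<alpha> a s b.
        h = (\<Sum>i<n. \<alpha> i \<cdot> (word (a i) * s i * word (b i))) \<and>
        (\<forall>i<n. s i \<in> S \<and> a i @ lead_word (s i) @ b i < w))"

text \<open>\<open>S\<close> is a Groebner-Shirshov basis of the ideal it generates.\<close>

definition groebner_shirshov_basis :: "('x::linorder, 'k::field) ncpoly set \<Rightarrow> bool" where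
  "groebner_shirshov_basis S \<longleftrightarrow>
     S \<noteq> {} \<and> (\<forall>f\<in>S. monic f) \<and>
     (\<forall>f\<in>S. \<forall>g\<in>S. \<forall>w h. composition f g w h \<longrightarrow> trivial_modulo S w h)"

datatype letter = Y1 | Y2 | X1 | X2

instantiation letter :: linorder
begin

primrec rank :: "letter \<Rightarrow> nat" where
  "rank Y1 = 0" | "rank Y2 = 1" | "rank X1 = 2" | "rank X2 = 3"

definition less_eq_letter :: "letter \<Rightarrow> letter \<Rightarrow> bool" where
  "less_eq_letter u v \<longleftrightarrow> rank u \<le> rank v"

definition less_letter :: "letter \<Rightarrow> letter \<Rightarrow> bool" where
  "less_letter u v \<longleftrightarrow> rank u < rank v"

instance
proof
  show "u = v" if "u \<le> v" "v \<le> u" for u v :: letter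
    using that by (cases u; cases v) (auto simp: less_eq_letter_def)
qed (auto simp: less_eq_letter_def less_letter_def)

end

abbreviation y1 :: "(letter, 'k::field) ncpoly" where "y1 \<equiv> word [Y1]"
abbreviation y2 :: "(letter, 'k::field) ncpoly" where "y2 \<equiv> word [Y2]"
abbreviation x1 :: "(letter, 'k::field) ncpoly" where "x1 \<equiv> word [X1]"
abbreviation x2 :: "(letter, 'k::field) ncpoly" where "x2 \<equiv> word [X2]"

definition E_relations :: "'k::field \<Rightarrow> ((letter, 'k) ncpoly \<times> (letter, 'k) ncpoly) set" where
  "E_relations p =
     {(x2 * x1, - (x1 * x2)),
      (y2 * y1, p \<cdot> (y1 * y2)),
      (y1 * x1, x1 * y2 + x2 * y2),
      (y1 * x2, x1 * y2 - x2 * y2),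
      (y2 * x1, - (x1 * y1) + x2 * y1),
      (y2 * x2, x1 * y1 + x2 * y1)}"

definition E_alg :: "'k::field \<Rightarrow> ('k, (letter, 'k) ncpoly set) module" where
  "E_alg p = presented_alg (E_relations p)"

definition S_polys :: "'k::field \<Rightarrow> (letter, 'k) ncpoly set" where
  "S_polys p =
     {x2 * x1 + x1 * x2,
      y2 * y1 - p \<cdot> (y1 * y2),
      x2 * y2 - (1/2) \<cdot> (y1 * x1) + (1/2) \<cdot> (y1 * x2),
      x1 * y2 - (1/2) \<cdot> (y1 * x1) - (1/2) \<cdot> (y1 * x2),
      x2 * y1 - (1/2) \<cdot> (y2 * x1) - (1/2) \<cdot> (y2 * x2),
      x1 * y1 + (1/2) \<cdot> (y2 * x1) - (1/2) \<cdot> (y2 * x2)}"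

end

theory Submission
  imports Defs
begin

text \<open>
  The six polynomials have the leading words
  \<open>x\<^sub>2x\<^sub>1, y\<^sub>2y\<^sub>1, x\<^sub>2y\<^sub>2, x\<^sub>1y\<^sub>2, x\<^sub>2y\<^sub>1, x\<^sub>1y\<^sub>1\<close>: pairwise distinct and all of length two.
  For such polynomials a composition is either the difference of a polynomial with itself, or it
  lives on a word of length three in which two leading words share the middle letter
  (\<open>composition_quadratic\<close>).  Only the words
  \<open>x\<^sub>2x\<^sub>1y\<^sub>2, x\<^sub>2x\<^sub>1y\<^sub>1, x\<^sub>2y\<^sub>2y\<^sub>1, x\<^sub>1y\<^sub>2y\<^sub>1\<close> arise, and for each of them reducing the composition by
  the six polynomials until nothing remains gives an explicit representation.
  In the first two cases the remainder before the last step is half of \<open>y\<^sub>2(x\<^sub>2x\<^sub>1 + x\<^sub>1x\<^sub>2)\<close>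
  or of \<open>y\<^sub>1(x\<^sub>2x\<^sub>1 + x\<^sub>1x\<^sub>2)\<close>, hence reduces to zero.  In the last two it is
  \<open>\<plusminus>(1 + p\<^sup>2)/2\<close> times a normal word, which is where \<open>p\<^sup>2 = -1\<close> enters.

  For the presentation, the two linear systems that solve the mixed defining relations for
  \<open>x\<^sub>iy\<^sub>j\<close> are invertible because \<open>2\<close> is, so each of the two generating sets consists of linear
  combinations of the other one.
\<close>

section \<open>Computing in the free algebra\<close>

lemma lookup_scale: "Poly_Mapping.lookup (c \<cdot> f) v = c * Poly_Mapping.lookup f v"
  by (simp add: scale_def Poly_Mapping.map.rep_eq when_def)

lemma scale_single: "c \<cdot> Poly_Mapping.single u d = Poly_Mapping.single u (c * d)"
  by (rule poly_mapping_eqI) (simp add: lookup_scale lookup_single when_def)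

lemma scale_add: "c \<cdot> (f + g) = c \<cdot> f + c \<cdot> g"
  by (rule poly_mapping_eqI) (simp add: lookup_scale lookup_add algebra_simps)

lemma scale_diff: "c \<cdot> (f - g) = c \<cdot> f - c \<cdot> g"
  by (rule poly_mapping_eqI) (simp add: lookup_scale lookup_minus algebra_simps)

lemma scale_eq_mult: "c \<cdot> f = Poly_Mapping.single [] c * f"
  by (simp add: scale_def mult_map_scale_conv_mult zero_list_def)

text \<open>Rewriting with these facts turns a polynomial expression into a sum of monomials; comparing
  the coefficients of such sums decides an identity in the free algebra.\<close>

lemmas monomial_expand =
  word_def scale_add scale_diff scale_single mult_single plus_list_def
  distrib_left distrib_right left_diff_distrib right_diff_distrib

lemmas coefficient_simps =
  lookup_add lookup_minus lookup_single when_def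

section \<open>Leading words\<close>

definition below :: "'x::linorder list \<Rightarrow> ('x, 'k::field) ncpoly \<Rightarrow> bool" where
  "below w f \<longleftrightarrow> (\<forall>v\<in>Poly_Mapping.keys f. v < w)"

lemma below_word: "v < w \<Longrightarrow> below w (word v)"
  by (simp add: below_def word_def)

lemma below_add: "below w f \<Longrightarrow> below w g \<Longrightarrow> below w (f + g)"
  unfolding below_def using Poly_Mapping.keys_add[of f g] by blast

lemma below_diff: "below w f \<Longrightarrow> below w g \<Longrightarrow> below w (f - g)"
  unfolding below_def using Poly_Mapping.keys_diff[of f g] by blast

lemma below_scale: "below w f \<Longrightarrow> below w (c \<cdot> f)"
  by (auto simp: below_def in_keys_iff lookup_scale)

lemmas below_intros = below_add below_diff below_scale below_word

lemma lead_word_monic: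
  assumes "below w r"
  shows "lead_word (word w + r) = w" and "monic (word w + r)"
proof -
  have "w \<notin> Poly_Mapping.keys r"
    using assms by (auto simp: below_def)
  then have coeff: "Poly_Mapping.lookup (word w + r) w = 1"
    by (simp add: lookup_add word_def in_keys_iff)
  then have key: "w \<in> Poly_Mapping.keys (word w + r)"
    by (simp add: in_keys_iff)
  have "v \<le> w" if "v \<in> Poly_Mapping.keys (word w + r)" for v
    using assms that Poly_Mapping.keys_add[of "word w" r]
    by (auto simp: below_def word_def less_imp_le)
  with key show lead: "lead_word (word w + r) = w"
    unfolding lead_word_def by (intro Max_eqI) auto
  show "monic (word w + r)"
    unfolding monic_def lead using coeff by auto
qed

section \<open>Compositions of polynomials with quadratic leading words\<close>

lemma word_Nil: "word [] = 1"
  by (simp add: word_def flip: zero_list_def)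

text \<open>A proper overlap of two words of length two consists of one letter; every other composition
  compares the polynomials along a full coincidence of their leading words.\<close>

lemma composition_quadratic:
  assumes comp: "composition f g w h"
    and len: "length (lead_word f) = 2" "length (lead_word g) = 2"
  shows "lead_word f = lead_word g \<and> h = f - g \<or>
    (\<exists>u v t. lead_word f = [u, v] \<and> lead_word g = [v, t] \<and> w = [u, v, t] \<and>
       h = f * word [t] - word [u] * g)"
  using comp
proof cases
  case (intersection a b)
  from intersection(2,3) have "lead_word f @ a = b @ lead_word g" by simp
  moreover obtain u v where f: "lead_word f = [u, v]"
    using len(1) by (auto simp: numeral_2_eq_2 length_Suc_conv)
  moreover obtain s t where g: "lead_word g = [s, t]"
    using len(2) by (auto simp: numeral_2_eq_2 length_Suc_conv)
  ultimately have eq: "u # v # a = b @ [s, t]" by simp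
  have "length a < 2"
    using intersection(2,4) f g by simp
  then consider "a = []" | x where "a = [x]"
    by (cases a; cases "tl a") auto
  then show ?thesis
  proof cases
    case 1
    with eq have "b = []" "u = s" "v = t"
      by (auto simp: Cons_eq_append_conv)
    with 1 f g intersection(1) show ?thesis
      by (simp add: word_Nil)
  next
    case 2
    with eq have "b = [u]" "v = s" "x = t"
      by (auto simp: Cons_eq_append_conv)
    with 2 f g intersection(1,2) show ?thesis by auto
  qed
next
  case (inclusion a b)
  then have "length (a @ lead_word g @ b) = 2" "lead_word f = a @ lead_word g @ b"
    using len by auto
  with len have "a = []" "b = []" by auto
  with inclusion show ?thesis
    by (simp add: word_Nil)
qed

text \<open>A single list of terms replaces the four parallel families in the definition, so that
  explicit representations can be written down.\<close>

lemma trivial_moduloI: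
  assumes "h = (\<Sum>(c, a, s, b)\<leftarrow>ts. c \<cdot> (word a * s * word b))"
    and "\<forall>(c, a, s, b)\<in>set ts. s \<in> S \<and> a @ lead_word s @ b < w"
  shows "trivial_modulo S w h"
  unfolding trivial_modulo_def
proof (intro exI conjI)
  show "h = (\<Sum>i<length ts. fst (ts ! i) \<cdot> (word (fst (snd (ts ! i))) *
      fst (snd (snd (ts ! i))) * word (snd (snd (snd (ts ! i))))))"
    by (simp add: assms(1) sum_list_sum_nth atLeast0LessThan case_prod_beta)
  show "\<forall>i<length ts. fst (snd (snd (ts ! i))) \<in> S \<and>
      fst (snd (ts ! i)) @ lead_word (fst (snd (snd (ts ! i)))) @ snd (snd (snd (ts ! i))) < w"
    using assms(2) by (auto simp: case_prod_beta dest!: nth_mem)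
qed

lemma trivial_modulo_zero: "trivial_modulo S w 0"
  by (rule trivial_moduloI[where ts = "[]"]) auto

section \<open>The six polynomials\<close>

text \<open>Each polynomial is named after its leading word.\<close>

definition s_x2x1 :: "(letter, 'k::field) ncpoly" where
  "s_x2x1 = x2 * x1 + x1 * x2"

definition s_y2y1 :: "'k::field \<Rightarrow> (letter, 'k) ncpoly" where
  "s_y2y1 p = y2 * y1 - p \<cdot> (y1 * y2)"

definition s_x2y2 :: "(letter, 'k::field) ncpoly" where
  "s_x2y2 = x2 * y2 - (1/2) \<cdot> (y1 * x1) + (1/2) \<cdot> (y1 * x2)"

definition s_x1y2 :: "(letter, 'k::field) ncpoly" where
  "s_x1y2 = x1 * y2 - (1/2) \<cdot> (y1 * x1) - (1/2) \<cdot> (y1 * x2)"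

definition s_x2y1 :: "(letter, 'k::field) ncpoly" where
  "s_x2y1 = x2 * y1 - (1/2) \<cdot> (y2 * x1) - (1/2) \<cdot> (y2 * x2)"

definition s_x1y1 :: "(letter, 'k::field) ncpoly" where
  "s_x1y1 = x1 * y1 + (1/2) \<cdot> (y2 * x1) - (1/2) \<cdot> (y2 * x2)"

lemmas s_defs = s_x2x1_def s_y2y1_def s_x2y2_def s_x1y2_def s_x2y1_def s_x1y1_def

lemma S_polys_eq: "S_polys p = {s_x2x1, s_y2y1 p, s_x2y2, s_x1y2, s_x2y1, s_x1y1}"
  by (simp add: S_polys_def s_defs)

lemmas word_less_simps = list_less_def Cons_lenlex_iff less_letter_def

lemma word_mult: "word u * word v = word (u @ v)"
  by (simp add: word_def mult_single plus_list_def)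

text \<open>The form required by \<open>lead_word_monic\<close>.\<close>

lemma s_split:
  "s_x2x1 = word [X2, X1] + x1 * x2"
  "s_y2y1 p = word [Y2, Y1] + (- p) \<cdot> (y1 * y2)"
  "s_x2y2 = word [X2, Y2] + ((1/2) \<cdot> (y1 * x2) - (1/2) \<cdot> (y1 * x1))"
  "s_x1y2 = word [X1, Y2] + ((- 1/2) \<cdot> (y1 * x1) - (1/2) \<cdot> (y1 * x2))"
  "s_x2y1 = word [X2, Y1] + ((- 1/2) \<cdot> (y2 * x1) - (1/2) \<cdot> (y2 * x2))"
  "s_x1y1 = word [X1, Y1] + ((1/2) \<cdot> (y2 * x1) - (1/2) \<cdot> (y2 * x2))"
  by (rule poly_mapping_eqI; simp add: s_defs monomial_expand coefficient_simps)+

lemma s_lead_word: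
  "lead_word (s_x2x1 :: (letter, 'k::field) ncpoly) = [X2, X1]"
  "lead_word (s_y2y1 p) = [Y2, Y1]"
  "lead_word (s_x2y2 :: (letter, 'k) ncpoly) = [X2, Y2]"
  "lead_word (s_x1y2 :: (letter, 'k) ncpoly) = [X1, Y2]"
  "lead_word (s_x2y1 :: (letter, 'k) ncpoly) = [X2, Y1]"
  "lead_word (s_x1y1 :: (letter, 'k) ncpoly) = [X1, Y1]"
  unfolding s_split word_mult
  by (rule lead_word_monic(1); intro below_intros; simp add: word_less_simps)+

lemma s_monic:
  "monic (s_x2x1 :: (letter, 'k::field) ncpoly)"
  "monic (s_y2y1 p)"
  "monic (s_x2y2 :: (letter, 'k) ncpoly)"
  "monic (s_x1y2 :: (letter, 'k) ncpoly)"
  "monic (s_x2y1 :: (letter, 'k) ncpoly)"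
  "monic (s_x1y1 :: (letter, 'k) ncpoly)"
  unfolding s_split word_mult
  by (rule lead_word_monic(2); intro below_intros; simp add: word_less_simps)+

section \<open>The four overlaps\<close>

lemma powers_of_two_nonzero:
  assumes "(2::'k::field) \<noteq> 0"
  shows "(2::'k) \<noteq> 0" "(4::'k) \<noteq> 0" "(8::'k) \<noteq> 0"
  using power_not_zero[OF assms, of 2] power_not_zero[OF assms, of 3] assms
  by simp_all

text \<open>The coefficients below record a reduction of each composition: each entry
  \<open>(c, a, s, b)\<close> replaces the occurrence of the leading word of \<open>s\<close> between \<open>a\<close> and \<open>b\<close> in a monomial with
  coefficient \<open>c\<close>.  Such a monomial is always smaller than the overlap word, and so is every
  monomial that replaces it, which is why the representations witness triviality.\<close>

lemma overlap_x2x1y2: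
  assumes "(2::'k::field) \<noteq> 0"
  shows "s_x2x1 * y2 - x2 * s_x1y2 = (\<Sum>(c, a, s, b)\<leftarrow>
    [(1, [X1], s_x2y2, []), (1/2, [], s_x1y1, [X1]), (-1/2, [], s_x1y1, [X2]),
     (1/2, [], s_x2y1, [X1]), (1/2, [], s_x2y1, [X2]), (1/2 :: 'k, [Y2], s_x2x1, [])].
     c \<cdot> (word a * s * word b))"
  using powers_of_two_nonzero[OF assms]
  by (intro poly_mapping_eqI)
     (auto simp: s_defs monomial_expand coefficient_simps field_simps)

lemma overlap_x2x1y1:
  assumes "(2::'k::field) \<noteq> 0"
  shows "s_x2x1 * y1 - x2 * s_x1y1 = (\<Sum>(c, a, s, b)\<leftarrow>
    [(1, [X1], s_x2y1, []), (1/2, [], s_x1y2, [X1]), (1/2, [], s_x1y2, [X2]),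
     (-1/2, [], s_x2y2, [X1]), (1/2, [], s_x2y2, [X2]), (1/2 :: 'k, [Y1], s_x2x1, [])].
     c \<cdot> (word a * s * word b))"
  using powers_of_two_nonzero[OF assms]
  by (intro poly_mapping_eqI)
     (auto simp: s_defs monomial_expand coefficient_simps field_simps)

lemma overlap_x2y2y1:
  assumes "(2::'k::field) \<noteq> 0" and "(p::'k)\<^sup>2 = -1"
  shows "s_x2y2 * y1 - x2 * s_y2y1 p = (\<Sum>(c, a, s, b)\<leftarrow>
    [(-1/2, [Y1], s_x1y1, []), (1/2, [Y1], s_x2y1, []), (p, [], s_x2y1, [Y2]),
     (p/2, [Y2], s_x1y2, []), (p/2, [Y2], s_x2y2, []), (p/2, [], s_y2y1 p, [X1])].
     c \<cdot> (word a * s * word b))"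
proof -
  have "p * p = -1" using assms(2) by (simp add: power2_eq_square)
  then show ?thesis using powers_of_two_nonzero[OF assms(1)]
    by (intro poly_mapping_eqI)
       (auto simp: s_defs monomial_expand coefficient_simps field_simps)
qed

lemma overlap_x1y2y1:
  assumes "(2::'k::field) \<noteq> 0" and "(p::'k)\<^sup>2 = -1"
  shows "s_x1y2 * y1 - x1 * s_y2y1 p = (\<Sum>(c, a, s, b)\<leftarrow>
    [(-1/2, [Y1], s_x1y1, []), (-1/2, [Y1], s_x2y1, []), (p, [], s_x1y1, [Y2]),
     (-p/2, [Y2], s_x1y2, []), (p/2, [Y2], s_x2y2, []), (-p/2, [], s_y2y1 p, [X2])].
     c \<cdot> (word a * s * word b))"
proof -
  have "p * p = -1" using assms(2) by (simp add: power2_eq_square)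
  then show ?thesis using powers_of_two_nonzero[OF assms(1)]
    by (intro poly_mapping_eqI)
       (auto simp: s_defs monomial_expand coefficient_simps field_simps)
qed

lemma S_polys_groebner_shirshov:
  fixes p :: "'k::field"
  assumes two: "(2::'k) \<noteq> 0" and p: "p\<^sup>2 = -1"
  shows "groebner_shirshov_basis (S_polys p)"
  unfolding groebner_shirshov_basis_def
proof (intro conjI ballI allI impI)
  show "S_polys p \<noteq> {}" by (simp add: S_polys_def)
  show "monic f" if "f \<in> S_polys p" for f
    using that s_monic by (auto simp: S_polys_eq)
  fix f g w h
  assume f: "f \<in> S_polys p" and g: "g \<in> S_polys p" and comp: "composition f g w h"
  have len: "length (lead_word f) = 2" "length (lead_word g) = 2"
    using f g by (auto simp: S_polys_eq s_lead_word)
  from composition_quadratic[OF comp len] show "trivial_modulo (S_polys p) w h"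
  proof (elim disjE exE conjE)
    assume "lead_word f = lead_word g" and h: "h = f - g"
    then have "f = g"
      using f g by (auto simp: S_polys_eq s_lead_word)
    then show ?thesis by (simp add: h trivial_modulo_zero)
  next
    fix u v t
    assume "lead_word f = [u, v]" "lead_word g = [v, t]" and w: "w = [u, v, t]"
      and h: "h = f * word [t] - word [u] * g"
    then consider
        "f = s_x2x1" "g = s_x1y2" "w = [X2, X1, Y2]" "h = s_x2x1 * y2 - x2 * s_x1y2"
      | "f = s_x2x1" "g = s_x1y1" "w = [X2, X1, Y1]" "h = s_x2x1 * y1 - x2 * s_x1y1"
      | "f = s_x2y2" "g = s_y2y1 p" "w = [X2, Y2, Y1]" "h = s_x2y2 * y1 - x2 * s_y2y1 p"
      | "f = s_x1y2" "g = s_y2y1 p" "w = [X1, Y2, Y1]" "h = s_x1y2 * y1 - x1 * s_y2y1 p"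
      using f g by (auto simp: S_polys_eq s_lead_word)
    then show ?thesis
    proof cases
      case 1
      show ?thesis unfolding 1(3,4)
        by (rule trivial_moduloI[OF overlap_x2x1y2[OF two]])
           (simp add: S_polys_eq s_lead_word word_less_simps)
    next
      case 2
      show ?thesis unfolding 2(3,4)
        by (rule trivial_moduloI[OF overlap_x2x1y1[OF two]])
           (simp add: S_polys_eq s_lead_word word_less_simps)
    next
      case 3
      show ?thesis unfolding 3(3,4)
        by (rule trivial_moduloI[OF overlap_x2y2y1[OF two p]])
           (simp add: S_polys_eq s_lead_word word_less_simps)
    next
      case 4
      show ?thesis unfolding 4(3,4)
        by (rule trivial_moduloI[OF overlap_x1y2y1[OF two p]])
           (simp add: S_polys_eq s_lead_word word_less_simps)
    qed
  qed
qed

section \<open>The ideal of defining relations\<close>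

lemma free_alg_simps:
  "carrier free_alg = UNIV" "f \<otimes>\<^bsub>free_alg\<^esub> g = f * g" "f \<oplus>\<^bsub>free_alg\<^esub> g = f + g"
  by (simp_all add: free_alg_def)

context
  fixes I :: "('x, 'k::field) ncpoly set"
  assumes I: "ideal I free_alg"
begin

lemma ideal_scale: "f \<in> I \<Longrightarrow> c \<cdot> f \<in> I"
  using ideal.I_l_closed[OF I, of f "Poly_Mapping.single [] c"]
  by (simp add: scale_eq_mult free_alg_simps)

lemma ideal_add: "f \<in> I \<Longrightarrow> g \<in> I \<Longrightarrow> f + g \<in> I"
  using additive_subgroup.a_closed[OF ideal.axioms(1)[OF I], of f g]
  by (simp add: free_alg_simps)

end

lemma genideal_eqI:
  assumes "\<And>I s. ideal I free_alg \<Longrightarrow> R \<subseteq> I \<Longrightarrow> s \<in> S \<Longrightarrow> s \<in> I"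
    and "\<And>I r. ideal I free_alg \<Longrightarrow> S \<subseteq> I \<Longrightarrow> r \<in> R \<Longrightarrow> r \<in> I"
  shows "Idl\<^bsub>free_alg\<^esub> S = Idl\<^bsub>free_alg\<^esub> (R :: ('x, 'k::field) ncpoly set)"
proof -
  have "ideal I free_alg \<and> S \<subseteq> I \<longleftrightarrow> ideal I free_alg \<and> R \<subseteq> I" for I
    using assms by blast
  then show ?thesis by (simp add: genideal_def)
qed

lemma E_relations_diff:
  "{l - r | l r. (l, r) \<in> E_relations p} =
    {s_x2x1, s_y2y1 p,
     y1 * x1 - (x1 * y2 + x2 * y2), y1 * x2 - (x1 * y2 - x2 * y2),
     y2 * x1 - (- (x1 * y1) + x2 * y1), y2 * x2 - (x1 * y1 + x2 * y1)}"
proof -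
  have "{l - r | l r. (l, r) \<in> E_relations p} = (\<lambda>(l, r). l - r) ` E_relations p"
    by force
  then show ?thesis by (simp add: E_relations_def s_defs)
qed

lemma s_from_relations:
  assumes "(2::'k::field) \<noteq> 0"
  shows "(s_x2y2 :: (letter, 'k) ncpoly) =
      (-1/2) \<cdot> (y1 * x1 - (x1 * y2 + x2 * y2)) + (1/2) \<cdot> (y1 * x2 - (x1 * y2 - x2 * y2))"
    and "(s_x1y2 :: (letter, 'k) ncpoly) =
      (-1/2) \<cdot> (y1 * x1 - (x1 * y2 + x2 * y2)) + (-1/2) \<cdot> (y1 * x2 - (x1 * y2 - x2 * y2))"
    and "(s_x2y1 :: (letter, 'k) ncpoly) =
      (-1/2) \<cdot> (y2 * x1 - (- (x1 * y1) + x2 * y1)) + (-1/2) \<cdot> (y2 * x2 - (x1 * y1 + x2 * y1))"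
    and "(s_x1y1 :: (letter, 'k) ncpoly) =
      (1/2) \<cdot> (y2 * x1 - (- (x1 * y1) + x2 * y1)) + (-1/2) \<cdot> (y2 * x2 - (x1 * y1 + x2 * y1))"
  using assms
  by (intro poly_mapping_eqI;
      auto simp: s_defs monomial_expand coefficient_simps field_simps lookup_uminus)+

lemma relations_from_s:
  assumes "(2::'k::field) \<noteq> 0"
  shows "y1 * x1 - (x1 * y2 + x2 * y2) = (-1::'k) \<cdot> s_x2y2 + (-1) \<cdot> s_x1y2"
    and "y1 * x2 - (x1 * y2 - x2 * y2) = (1::'k) \<cdot> s_x2y2 + (-1) \<cdot> s_x1y2"
    and "y2 * x1 - (- (x1 * y1) + x2 * y1) = (-1::'k) \<cdot> s_x2y1 + 1 \<cdot> s_x1y1"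
    and "y2 * x2 - (x1 * y1 + x2 * y1) = (-1::'k) \<cdot> s_x2y1 + (-1) \<cdot> s_x1y1"
  using assms
  by (intro poly_mapping_eqI;
      auto simp: s_defs monomial_expand coefficient_simps field_simps lookup_uminus)+

lemma ideal_S_polys:
  fixes p :: "'k::field"
  assumes two: "(2::'k) \<noteq> 0"
  shows "Idl\<^bsub>free_alg\<^esub> (S_polys p) = ideal_of_relations (E_relations p)"
  unfolding ideal_of_relations_def E_relations_diff S_polys_eq
proof (rule genideal_eqI)
  fix I :: "(letter, 'k) ncpoly set" and s
  assume I: "ideal I free_alg"
    and sub: "{s_x2x1, s_y2y1 p,
     y1 * x1 - (x1 * y2 + x2 * y2), y1 * x2 - (x1 * y2 - x2 * y2),
     y2 * x1 - (- (x1 * y1) + x2 * y1), y2 * x2 - (x1 * y1 + x2 * y1)} \<subseteq> I"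
    and s: "s \<in> {s_x2x1, s_y2y1 p, s_x2y2, s_x1y2, s_x2y1, s_x1y1}"
  have "s_x2y2 \<in> I" "s_x1y2 \<in> I" "s_x2y1 \<in> I" "s_x1y1 \<in> I"
    unfolding s_from_relations[OF two]
    by (intro ideal_add[OF I] ideal_scale[OF I]; use sub in simp)+
  with s sub show "s \<in> I" by auto
next
  fix I :: "(letter, 'k) ncpoly set" and r
  assume I: "ideal I free_alg"
    and sub: "{s_x2x1, s_y2y1 p, s_x2y2, s_x1y2, s_x2y1, s_x1y1} \<subseteq> I"
    and r: "r \<in> {s_x2x1, s_y2y1 p,
     y1 * x1 - (x1 * y2 + x2 * y2), y1 * x2 - (x1 * y2 - x2 * y2),
     y2 * x1 - (- (x1 * y1) + x2 * y1), y2 * x2 - (x1 * y1 + x2 * y1)}"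
  have "c \<cdot> f + d \<cdot> g \<in> I" if "f \<in> I" "g \<in> I" for c d f g
    using that by (intro ideal_add[OF I] ideal_scale[OF I])
  with r sub show "r \<in> I"
    unfolding relations_from_s[OF two] by auto
qed

lemma two_nonzero:
  assumes "CHAR('k::field) \<noteq> 2"
  shows "(2::'k) \<noteq> 0"
proof
  assume "(2::'k) = 0"
  then have "CHAR('k) dvd 2"
    by (metis of_nat_eq_0_iff_char_dvd of_nat_numeral)
  then have "CHAR('k) \<le> 2" "CHAR('k) \<noteq> 0"
    by (simp add: dvd_imp_le, metis \<open>CHAR('k) dvd 2\<close> dvd_0_left_iff zero_neq_numeral)
  moreover have "CHAR('k) \<noteq> Suc 0" by (rule CHAR_not_1)
  ultimately show False using assms by linarith
qed

theorem mainTheorem4: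
  fixes p :: "'k::field"
  assumes "CHAR('k) \<noteq> 2" and "p\<^sup>2 = -1"
  shows "groebner_shirshov_basis (S_polys p)
    \<and> Idl\<^bsub>free_alg\<^esub> (S_polys p) = ideal_of_relations (E_relations p)
    \<and> E_alg p = quot_alg free_alg (Idl\<^bsub>free_alg\<^esub> (S_polys p))"
proof -
  have two: "(2::'k) \<noteq> 0" by (rule two_nonzero[OF assms(1)])
  show ?thesis
    using S_polys_groebner_shirshov[OF two assms(2)] ideal_S_polys[OF two, of p]
    by (simp add: E_alg_def presented_alg_def)
qed

end
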